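(* Let $X$ be a nonempty compact metric space and let $f\colon X\to X$ be a continuous map with the shadowing property. Then the following properties are equivalent: \begin{itemize} \item[(1)] $f$ is chain sensitive and chain proximal; \item[(2)] $f$ is chain proximal, and the unique chain stable chain component $C$ for $f$ is not a singleton; \item[(3)] $f$ exhibits $gu{\rm C}$; \item[(4)] $f$ exhibits $du{\rm C}$; \item[(5)] $f$ exhibits $g{\rm C}$. \end{itemize}
   Context: $d$ denotes the metric of $X$, and $f\colon X\to X$ is continuous. Chains and shadowing. For $\delta>0$, a $\delta$-chain of $f$ is a finite sequence $(x_i)_{i=0}^k$ in $X$, with $k$ a positive integer, such that $d(f(x_i),x_{i+1})\le\delta$ for every $0\le i\le k-1$. A $\delta$-pseudo orbit of $f$ is an infinite sequence $(x_i)_{i\ge0}$ in $X$ with $d(f(x_i),x_{i+1})\le\delta$ for all $i\ge0$. A sequence $(x_i)_{i\ge0}$ is $\epsilon$-shadowed by $x\in X$ if $d(f^i(x),x_i)\le\epsilon$ for all $i\ge0$. The map $f$ has the shadowing property if for every $\epsilon>0$ there is $\delta>0$ such that every $\delta$-pseudo orbit of $f$ is $\epsilon$-shadowed by some $x\in X$. Chaos. For $\delta>0$, ${\rm C}_\delta(X,f)$ is the set of $(x,y)\in X^2$ with $\limsup_{i\to\infty}d(f^i(x),f^i(y))\ge\delta$ and $\liminf_{i\to\infty}d(f^i(x),f^i(y))=0$; put ${\rm C}(X,f)=\bigcup_{\delta>0}{\rm C}_\delta(X,f)$. The map $f$ exhibits $gu{\rm C}$ if ${\rm C}_\delta(X,f)$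 is a residual subset of $X^2$ for some $\delta>0$; $du{\rm C}$ if ${\rm C}_\delta(X,f)$ is a dense subset of $X^2$ for some $\delta>0$; $g{\rm C}$ if ${\rm C}(X,f)$ is a residual subset of $X^2$. Chain proximality. $f$ is chain proximal if for every $(x,y)\in X^2$ and every $\delta>0$ there is a pair $((x_i)_{i=0}^k,(y_i)_{i=0}^k)$ of $\delta$-chains of $f$ with $(x_0,y_0)=(x,y)$ and $x_k=y_k$. Chain sensitivity. For $e>0$, $x\in X$ is a chain $e$-sensitive point for $f$ if for every $\delta>0$ there is a pair $((x_i)_{i=0}^k,(y_i)_{i=0}^k)$ of $\delta$-chains of $f$ with $x_0=y_0=x$ and $d(x_k,y_k)>e$. $f$ is chain sensitive if there is $e>0$ such that every $x\in X$ is a chain $e$-sensitive point for $f$. Chain components. A point $x\in X$ is chain recurrent for $f$ if for every $\delta>0$ there is a $\delta$-chain $(x_i)_{i=0}^k$ of $f$ with $x_0=x_k=x$; $CR(f)$ is the set of chain recurrent points. For $x,y\in X$ write $x\rightarrow y$ if for every $\delta>0$ there is a $\delta$-chain $(x_i)_{i=0}^k$ of $f$ with $x_0=x$ and $x_k=y$. The relation on $CR(f)$ given by $x\leftrightarrow y$ iff $x\rightarrow y$ and $y\rightarrow x$ is an equivalence relation; its equivalence classes are the chain components for $f$. Each is a closed subset $C$ with $f(C)\subset C$. Chain stability. A closed set $S\subset X$ with $f(S)\subset S$ is chain stable if for every $\epsilon>0$ there is $\delta>0$ such that every $\delta$-chain $(x_i)_{i=0}^k$ of $f$ with $x_0\in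 S$ satisfies $d(x_i,S)\le\epsilon$ for all $0\le i\le k$, where $d(x,S)=\inf_{s\in S}d(x,s)$. A chain proximal map has exactly one chain stable chain component; "the unique chain stable chain component" in (2) refers to it. *)

theory Defs
  imports "HOL-Analysis.Analysis"
begin

text \<open>
  The space \<open>X\<close> is the whole type \<open>'a\<close>; compactness is assumed where needed as
  \<open>compact (UNIV :: 'a set)\<close>, and nonemptiness holds for every type.
  The square of \<open>X\<close> is \<open>'a \<times> 'a\<close> with the library's product topology.
\<close>

text \<open>A finite sequence \<open>(x\<^sub>0, \<dots>, x\<^sub>k)\<close> is given by its top index \<open>k\<close> and a function on \<open>nat\<close>
  of which only the values at \<open>0, \<dots>, k\<close> are relevant.\<close>

definition delta_chain :: "('a::metric_space \<Rightarrow> 'a) \<Rightarrow> real \<Rightarrow> nat \<Rightarrow> (nat \<Rightarrow> 'a) \<Rightarrow> bool" where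
  "delta_chain f \<delta> k x \<longleftrightarrow> 0 < k \<and> (\<forall>i<k. dist (f (x i)) (x (Suc i)) \<le> \<delta>)"

definition pseudo_orbit :: "('a::metric_space \<Rightarrow> 'a) \<Rightarrow> real \<Rightarrow> (nat \<Rightarrow> 'a) \<Rightarrow> bool" where
  "pseudo_orbit f \<delta> x \<longleftrightarrow> (\<forall>i. dist (f (x i)) (x (Suc i)) \<le> \<delta>)"

definition shadowed_by :: "('a::metric_space \<Rightarrow> 'a) \<Rightarrow> real \<Rightarrow> (nat \<Rightarrow> 'a) \<Rightarrow> 'a \<Rightarrow> bool" where
  "shadowed_by f \<epsilon> x p \<longleftrightarrow> (\<forall>i. dist ((f ^^ i) p) (x i) \<le> \<epsilon>)"

definition shadowing_property :: "('a::metric_space \<Rightarrow> 'a) \<Rightarrow> bool" where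
  "shadowing_property f \<longleftrightarrow>
     (\<forall>\<epsilon>>0. \<exists>\<delta>>0. \<forall>x. pseudo_orbit f \<delta> x \<longrightarrow> (\<exists>p. shadowed_by f \<epsilon> x p))"

definition residual :: "'b::topological_space set \<Rightarrow> bool" where
  "residual S \<longleftrightarrow>
     (\<exists>\<G>. countable \<G> \<and> (\<forall>U\<in>\<G>. open U \<and> closure U = UNIV) \<and> \<Inter>\<G> \<subseteq> S)"

text \<open>The upper and lower limits are taken in \<open>ereal\<close>, since \<open>limsup\<close> and \<open>liminf\<close> need a
  complete lattice.\<close>

definition chaotic_pairs_delta :: "real \<Rightarrow> ('a::metric_space \<Rightarrow> 'a) \<Rightarrow> ('a \<times> 'a) set" where
  "chaotic_pairs_delta \<delta> f =
     {(x, y). limsup (\<lambda>i. ereal (dist ((f ^^ i) x) ((f ^^ i) y))) \<ge> ereal \<delta> \<and>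
              liminf (\<lambda>i. ereal (dist ((f ^^ i) x) ((f ^^ i) y))) = 0}"

definition chaotic_pairs :: "('a::metric_space \<Rightarrow> 'a) \<Rightarrow> ('a \<times> 'a) set" where
  "chaotic_pairs f = (\<Union>\<delta>\<in>{0<..}. chaotic_pairs_delta \<delta> f)"

definition exhibits_guC :: "('a::metric_space \<Rightarrow> 'a) \<Rightarrow> bool" where
  "exhibits_guC f \<longleftrightarrow> (\<exists>\<delta>>0. residual (chaotic_pairs_delta \<delta> f))"

definition exhibits_duC :: "('a::metric_space \<Rightarrow> 'a) \<Rightarrow> bool" where
  "exhibits_duC f \<longleftrightarrow> (\<exists>\<delta>>0. closure (chaotic_pairs_delta \<delta> f) = UNIV)"

definition exhibits_gC :: "('a::metric_space \<Rightarrow> 'a) \<Rightarrow> bool" where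
  "exhibits_gC f \<longleftrightarrow> residual (chaotic_pairs f)"

definition chain_proximal :: "('a::metric_space \<Rightarrow> 'a) \<Rightarrow> bool" where
  "chain_proximal f \<longleftrightarrow>
     (\<forall>p q. \<forall>\<delta>>0. \<exists>k x y. delta_chain f \<delta> k x \<and> delta_chain f \<delta> k y \<and>
        x 0 = p \<and> y 0 = q \<and> x k = y k)"

definition chain_sensitive_point :: "('a::metric_space \<Rightarrow> 'a) \<Rightarrow> real \<Rightarrow> 'a \<Rightarrow> bool" where
  "chain_sensitive_point f e p \<longleftrightarrow>
     (\<forall>\<delta>>0. \<exists>k x y. delta_chain f \<delta> k x \<and> delta_chain f \<delta> k y \<and>
        x 0 = p \<and> y 0 = p \<and> dist (x k) (y k) > e)"

definition chain_sensitive :: "('a::metric_space \<Rightarrow> 'a) \<Rightarrow> bool" where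
  "chain_sensitive f \<longleftrightarrow> (\<exists>e>0. \<forall>p. chain_sensitive_point f e p)"

definition chain_reaches :: "('a::metric_space \<Rightarrow> 'a) \<Rightarrow> 'a \<Rightarrow> 'a \<Rightarrow> bool" where
  "chain_reaches f p q \<longleftrightarrow> (\<forall>\<delta>>0. \<exists>k x. delta_chain f \<delta> k x \<and> x 0 = p \<and> x k = q)"

definition chain_recurrent_set :: "('a::metric_space \<Rightarrow> 'a) \<Rightarrow> 'a set" where
  "chain_recurrent_set f = {p. \<forall>\<delta>>0. \<exists>k x. delta_chain f \<delta> k x \<and> x 0 = p \<and> x k = p}"

definition chain_equiv :: "('a::metric_space \<Rightarrow> 'a) \<Rightarrow> ('a \<times> 'a) set" where
  "chain_equiv f =
     {(p, q). p \<in> chain_recurrent_set f \<and> q \<in> chain_recurrent_set f \<and>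
              chain_reaches f p q \<and> chain_reaches f q p}"

definition chain_components :: "('a::metric_space \<Rightarrow> 'a) \<Rightarrow> 'a set set" where
  "chain_components f = chain_recurrent_set f // chain_equiv f"

definition chain_stable :: "('a::metric_space \<Rightarrow> 'a) \<Rightarrow> 'a set \<Rightarrow> bool" where
  "chain_stable f S \<longleftrightarrow>
     closed S \<and> f ` S \<subseteq> S \<and>
     (\<forall>\<epsilon>>0. \<exists>\<delta>>0. \<forall>k x. delta_chain f \<delta> k x \<and> x 0 \<in> S \<longrightarrow> (\<forall>i\<le>k. infdist (x i) S \<le> \<epsilon>))"

text \<open>For chain proximal \<open>f\<close> on a nonempty compact space there is exactly one such \<open>C\<close>. The
  component is described by a predicate rather than by \<open>THE\<close>, which would be unspecified where
  existence or uniqueness fails.\<close>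

definition unique_chain_stable_component :: "('a::metric_space \<Rightarrow> 'a) \<Rightarrow> 'a set \<Rightarrow> bool" where
  "unique_chain_stable_component f C \<longleftrightarrow>
     C \<in> chain_components f \<and> chain_stable f C \<and>
     (\<forall>D \<in> chain_components f. chain_stable f D \<longrightarrow> D = C)"

end

theory Submission
  imports Defs
begin

text \<open>
  Everything is read off the set \<open>T\<close> of points that every point reaches by chains of arbitrarily
  small jumps. For a chain proximal map on a compact space \<open>T\<close> is nonempty, because any two points
  reach a common one, so that the closed sets of reachable points form a directed family; and
  nothing outside \<open>T\<close> is reachable from \<open>T\<close>, which makes \<open>T\<close> the unique chain stable chain component
  (\<open>unique_chain_stable_component_iff\<close>). The five properties are shown to be equivalent to: \<open>f\<close> is
  chain proximal and \<open>T\<close> has more than one point.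

  The arithmetic heart is \<open>chain_joins_terminal_eventually\<close>: chain proximality applied to the pair
  \<open>(q, f q)\<close> with \<open>q\<close> in \<open>T\<close> gives cycles through \<open>q\<close> of two consecutive lengths, so every point can
  be joined to \<open>q\<close> by a chain of every large length. In particular a point can be joined to two
  points \<open>p \<noteq> q\<close> of \<open>T\<close> by chains of equal length, which is chain sensitivity. With shadowing such
  chains are followed by true orbits. Hence for \<open>p, q\<close> in \<open>T\<close> a generic pair \<open>(x, y)\<close> comes close to
  \<open>(p, q)\<close> at infinitely many times (\<open>residual_visits_terminal_pair\<close>). Taking \<open>(p, p)\<close> and \<open>(p, q)\<close>
  with \<open>p \<noteq> q\<close> bounds the lower limit of distances by \<open>0\<close> and the upper limit from below by the
  distance from \<open>p\<close> to \<open>q\<close>, so generic pairs are uniformly chaotic.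

  Conversely, a residual set is dense by the Baire theorem, and if chaotic pairs are dense, then
  near any pair there is a proximal one, whose orbits provide chains to a common point. Suppose now
  that \<open>T\<close> is a single point \<open>c\<close>. Chain stability makes \<open>c\<close> Lyapunov stable, so no pair near \<open>(c, c)\<close>
  has a large upper limit of distances, against density of one set of uniformly chaotic pairs. A
  union of such sets over all separation constants might still be dense; here shadowing is used
  again: a generic pair comes arbitrarily near \<open>(c, c)\<close>, hence stays near it and is asymptotic, so
  chaotic pairs do not form a residual set.
\<close>

section \<open>Chains between two points\<close>

text \<open>
  The number \<open>k\<close> of jumps is kept as an index because both chain proximality and chain sensitivity
  compare chains of equal length.
\<close>

definition chain_joins :: "('a::metric_space \<Rightarrow> 'a) \<Rightarrow> real \<Rightarrow> nat \<Rightarrow> 'a \<Rightarrow> 'a \<Rightarrow> bool" where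
  "chain_joins f \<delta> k p q \<longleftrightarrow> (\<exists>x. delta_chain f \<delta> k x \<and> x 0 = p \<and> x k = q)"

lemma chain_reaches_iff_joins: "chain_reaches f p q \<longleftrightarrow> (\<forall>\<delta>>0. \<exists>k. chain_joins f \<delta> k p q)"
  by (simp add: chain_reaches_def chain_joins_def)

lemma chain_recurrent_iff_reaches: "p \<in> chain_recurrent_set f \<longleftrightarrow> chain_reaches f p p"
  by (simp add: chain_recurrent_set_def chain_reaches_def)

lemma chain_proximal_iff_joins:
  "chain_proximal f \<longleftrightarrow>
     (\<forall>p q. \<forall>\<delta>>0. \<exists>k z. chain_joins f \<delta> k p z \<and> chain_joins f \<delta> k q z)"
  unfolding chain_proximal_def chain_joins_def by metis

lemma chain_joins_mono: "chain_joins f \<delta> k p q \<Longrightarrow> \<delta> \<le> \<delta>' \<Longrightarrow> chain_joins f \<delta>' k p q"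
  unfolding chain_joins_def delta_chain_def by (elim exE, rule exI) (auto elim: order_trans)

lemma chain_joins_pos: "chain_joins f \<delta> k p q \<Longrightarrow> 0 < k"
  by (auto simp: chain_joins_def delta_chain_def)

lemma chain_joins_trans:
  assumes "chain_joins f \<delta> k p q" and "chain_joins f \<delta> m q r"
  shows "chain_joins f \<delta> (k + m) p r"
proof -
  obtain x where x: "0 < k" "\<And>i. i < k \<Longrightarrow> dist (f (x i)) (x (Suc i)) \<le> \<delta>" "x 0 = p" "x k = q"
    using assms(1) by (auto simp: chain_joins_def delta_chain_def)
  obtain y where y: "0 < m" "\<And>i. i < m \<Longrightarrow> dist (f (y i)) (y (Suc i)) \<le> \<delta>" "y 0 = q" "y m = r"
    using assms(2) by (auto simp: chain_joins_def delta_chain_def)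
  define z where "z i = (if i \<le> k then x i else y (i - k))" for i
  have "dist (f (z i)) (z (Suc i)) \<le> \<delta>" if "i < k + m" for i
  proof (cases "i < k")
    case True
    then show ?thesis using x(2)[of i] by (simp add: z_def)
  next
    case False
    then have "z i = y (i - k)" "z (Suc i) = y (Suc (i - k))"
      using x y by (auto simp: z_def Suc_diff_le)
    then show ?thesis using y(2)[of "i - k"] that False by auto
  qed
  moreover have "z 0 = p" "z (k + m) = r" using x y by (auto simp: z_def)
  ultimately show ?thesis
    using x(1) unfolding chain_joins_def delta_chain_def by (intro exI[of _ z]) auto
qed

lemma chain_joins_move_start:
  assumes "chain_joins f \<delta> k p q" and "dist (f p') (f p) \<le> \<eta>"
  shows "chain_joins f (\<delta> + \<eta>) k p' q"
proof -
  obtain x where x: "0 < k" "\<And>i. i < k \<Longrightarrow> dist (f (x i)) (x (Suc i)) \<le> \<delta>" "x 0 = p" "x k = q"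
    using assms(1) by (auto simp: chain_joins_def delta_chain_def)
  have "0 \<le> \<eta>" using assms(2) zero_le_dist order_trans by blast
  then have "dist (f ((x(0 := p')) i)) ((x(0 := p')) (Suc i)) \<le> \<delta> + \<eta>" if "i < k" for i
    using x(2)[OF that] assms(2) x(3) dist_triangle[of "f p'" "x (Suc i)" "f p"]
      by (cases i) auto
  then show ?thesis using x unfolding chain_joins_def delta_chain_def
    by (intro exI[of _ "x(0 := p')"]) auto
qed

lemma chain_joins_move_end:
  assumes "chain_joins f \<delta> k p q" and "dist q q' \<le> \<eta>"
  shows "chain_joins f (\<delta> + \<eta>) k p q'"
proof -
  obtain x where x: "0 < k" "\<And>i. i < k \<Longrightarrow> dist (f (x i)) (x (Suc i)) \<le> \<delta>" "x 0 = p" "x k = q"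
    using assms(1) by (auto simp: chain_joins_def delta_chain_def)
  have "0 \<le> \<eta>" using assms(2) zero_le_dist order_trans by blast
  then have "dist (f ((x(k := q')) i)) ((x(k := q')) (Suc i)) \<le> \<delta> + \<eta>" if "i < k" for i
    using x(2)[OF that] assms(2) x(4) that dist_triangle[of "f (x i)" q' q]
      by (cases "Suc i = k") auto
  then show ?thesis using x unfolding chain_joins_def delta_chain_def
    by (intro exI[of _ "x(k := q')"]) auto
qed

lemma chain_joins_orbit:
  assumes "0 < k" and "0 \<le> \<delta>"
  shows "chain_joins f \<delta> k p ((f ^^ k) p)"
  using assms unfolding chain_joins_def delta_chain_def
  by (intro exI[of _ "\<lambda>i. (f ^^ i) p"]) auto

lemma chain_reaches_trans:
  "chain_reaches f p q \<Longrightarrow> chain_reaches f q r \<Longrightarrow> chain_reaches f p r"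
  unfolding chain_reaches_iff_joins using chain_joins_trans by meson

lemma chain_reaches_image: "chain_reaches f p (f p)"
  unfolding chain_reaches_iff_joins
proof (intro allI impI)
  fix \<delta> :: real assume "0 < \<delta>"
  then have "chain_joins f \<delta> 1 p (f p)" using chain_joins_orbit[of 1 \<delta> f p] by simp
  then show "\<exists>k. chain_joins f \<delta> k p (f p)" by blast
qed

text \<open>
  Limits of endpoints of finer and finer chains are joined by chains: changing the last point costs
  its displacement, and changing the first point costs the displacement of its image, which is small
  by continuity. The lengths of the chains may grow without bound.
\<close>

lemma chain_reaches_limit:
  assumes cont: "continuous_on UNIV f"
    and joins: "\<And>n::nat. \<exists>k. chain_joins f (\<delta> n) k (p n) (q n)"
    and lim: "\<delta> \<longlonglongrightarrow> 0" "p \<longlonglongrightarrow> p'" "q \<longlonglongrightarrow> q'"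
  shows "chain_reaches f p' q'"
  unfolding chain_reaches_iff_joins
proof (intro allI impI)
  fix d :: real assume "0 < d"
  then have d: "0 < d / 3" by simp
  have "(\<lambda>n. f (p n)) \<longlonglongrightarrow> f p'"
    using continuous_on_tendsto_compose[OF cont lim(2)] by simp
  then have "\<forall>\<^sub>F n in sequentially. dist (f (p n)) (f p') < d / 3"
    using d by (rule tendstoD)
  moreover have "\<forall>\<^sub>F n in sequentially. dist (\<delta> n) 0 < d / 3"
    "\<forall>\<^sub>F n in sequentially. dist (q n) q' < d / 3"
    using tendstoD[OF lim(1) d] tendstoD[OF lim(3) d] .
  ultimately have "\<forall>\<^sub>F n in sequentially.
      dist (f (p n)) (f p') < d / 3 \<and> dist (\<delta> n) 0 < d / 3 \<and> dist (q n) q' < d / 3"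
    by eventually_elim auto
  then obtain n where n: "dist (f (p n)) (f p') < d / 3" "dist (\<delta> n) 0 < d / 3"
    "dist (q n) q' < d / 3"
    by (auto simp: eventually_sequentially)
  obtain k where "chain_joins f (\<delta> n) k (p n) (q n)" using joins by blast
  then have "chain_joins f (\<delta> n + d/3) k p' (q n)"
    by (rule chain_joins_move_start) (use n in \<open>simp add: dist_commute\<close>)
  then have "chain_joins f (\<delta> n + d/3 + d/3) k p' q'"
    by (rule chain_joins_move_end) (use n in simp)
  then have "chain_joins f d k p' q'"
    by (rule chain_joins_mono) (use n in simp)
  then show "\<exists>k. chain_joins f d k p' q'" by blast
qed

lemma closed_chain_reaches:
  assumes "continuous_on UNIV f"
  shows "closed {q. chain_reaches f p q}"
  unfolding closed_sequential_limits
proof clarify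
  fix q l assume q: "\<forall>n. q n \<in> {q. chain_reaches f p q}" "q \<longlonglongrightarrow> l"
  show "chain_reaches f p l"
  proof (rule chain_reaches_limit[OF assms])
    show "\<exists>k. chain_joins f (inverse (real (Suc n))) k p (q n)" for n
    proof -
      have "chain_reaches f p (q n)" using q(1) by simp
      then show ?thesis unfolding chain_reaches_iff_joins
        by (metis inverse_positive_iff_positive of_nat_0_less_iff zero_less_Suc)
    qed
  qed (use LIMSEQ_inverse_real_of_nat q(2) in simp_all)
qed

section \<open>The terminal chain component\<close>

text \<open>
  The greatest elements of the preorder of chain reachability.
\<close>

definition terminal_set :: "('a::metric_space \<Rightarrow> 'a) \<Rightarrow> 'a set" where
  "terminal_set f = {q. \<forall>p. chain_reaches f p q}"

lemma chain_proximal_common_target: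
  fixes f :: "'a::metric_space \<Rightarrow> 'a"
  assumes compact_X: "compact (UNIV :: 'a set)" and cont: "continuous_on UNIV f"
    and prox: "chain_proximal f"
  shows "\<exists>z. chain_reaches f p z \<and> chain_reaches f q z"
proof -
  let ?\<delta> = "\<lambda>n. inverse (real (Suc n))"
  have "\<forall>n. \<exists>z. \<exists>k. chain_joins f (?\<delta> n) k p z \<and> chain_joins f (?\<delta> n) k q z"
    using prox unfolding chain_proximal_iff_joins
    by (metis inverse_positive_iff_positive of_nat_0_less_iff zero_less_Suc)
  then obtain z where z: "\<And>n. \<exists>k. chain_joins f (?\<delta> n) k p (z n) \<and> chain_joins f (?\<delta> n) k q (z n)"
    by metis
  have "seq_compact (UNIV :: 'a set)" using compact_X by (simp add: compact_eq_seq_compact_metric)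
  then obtain l r where r: "strict_mono (r :: nat \<Rightarrow> nat)" "(z \<circ> r) \<longlonglongrightarrow> l"
    by (rule seq_compactE[where f = z]) auto
  have \<delta>: "(?\<delta> \<circ> r) \<longlonglongrightarrow> 0"
    using LIMSEQ_subseq_LIMSEQ[OF LIMSEQ_inverse_real_of_nat r(1)] .
  have "chain_reaches f p l" "chain_reaches f q l"
    by (rule chain_reaches_limit[OF cont _ \<delta> _ r(2)]; use z in fastforce)+
  then show ?thesis by blast
qed

text \<open>
  Since two points always reach a common point, any finite set of points does, by transitivity. So
  the closed sets of points reachable from a given point have the finite intersection property.
\<close>

lemma terminal_set_nonempty:
  fixes f :: "'a::metric_space \<Rightarrow> 'a"
  assumes compact_X: "compact (UNIV :: 'a set)" and cont: "continuous_on UNIV f"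
    and prox: "chain_proximal f"
  shows "terminal_set f \<noteq> {}"
proof -
  have common: "\<exists>z. \<forall>p\<in>I. chain_reaches f p z" if "finite I" for I
    using that
  proof induction
    case (insert a I)
    then obtain z where z: "\<forall>p\<in>I. chain_reaches f p z" by blast
    obtain w where "chain_reaches f a w" "chain_reaches f z w"
      using chain_proximal_common_target[OF assms] by blast
    with z show ?case using chain_reaches_trans by (intro exI[of _ w]) blast
  qed simp
  have "UNIV \<inter> (\<Inter>p\<in>UNIV. {q. chain_reaches f p q}) \<noteq> {}"
  proof (rule compact_imp_fip_image[OF compact_X])
    show "UNIV \<inter> (\<Inter>p\<in>I. {q. chain_reaches f p q}) \<noteq> {}" if "finite I" for I
      using common[OF that] by auto
  qed (rule closed_chain_reaches[OF cont])
  then show ?thesis by (auto simp: terminal_set_def)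
qed

lemma terminal_set_reaches:
  "p \<in> terminal_set f \<Longrightarrow> chain_reaches f p q \<Longrightarrow> q \<in> terminal_set f"
  unfolding terminal_set_def using chain_reaches_trans by blast

lemma chain_equiv_class_terminal:
  assumes "p \<in> terminal_set f"
  shows "chain_equiv f `` {p} = terminal_set f"
  using assms terminal_set_reaches[OF assms]
  by (auto simp: chain_equiv_def chain_recurrent_iff_reaches terminal_set_def)

lemma closed_terminal_set:
  assumes "continuous_on UNIV f"
  shows "closed (terminal_set f)"
proof -
  have "terminal_set f = (\<Inter>p. {q. chain_reaches f p q})" by (auto simp: terminal_set_def)
  then show ?thesis using closed_chain_reaches[OF assms] by auto
qed

text \<open>
  If finer and finer chains from \<open>T\<close> led to points at distance more than \<open>\<epsilon>\<close> from \<open>T\<close>, a limit of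
  their endpoints would be reachable from a limit of their starting points, which lies in the closed
  set \<open>T\<close>. But whatever is reachable from \<open>T\<close> is in \<open>T\<close>.
\<close>

lemma chain_stable_terminal_set:
  fixes f :: "'a::metric_space \<Rightarrow> 'a"
  assumes compact_X: "compact (UNIV :: 'a set)" and cont: "continuous_on UNIV f"
  shows "chain_stable f (terminal_set f)"
  unfolding chain_stable_def
proof (intro conjI allI impI)
  let ?T = "terminal_set f"
  show "closed ?T" by (rule closed_terminal_set[OF cont])
  show "f ` ?T \<subseteq> ?T" using terminal_set_reaches chain_reaches_image by blast
  fix \<epsilon> :: real assume "0 < \<epsilon>"
  show "\<exists>\<delta>>0. \<forall>k x. delta_chain f \<delta> k x \<and> x 0 \<in> ?T \<longrightarrow> (\<forall>i\<le>k. infdist (x i) ?T \<le> \<epsilon>)"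
  proof (rule ccontr)
    assume neg: "\<not> ?thesis"
    let ?\<delta> = "\<lambda>n. inverse (real (Suc n))"
    have "\<forall>n. \<exists>s w k. s \<in> ?T \<and> chain_joins f (?\<delta> n) k s w \<and> \<epsilon> < infdist w ?T"
    proof
      fix n
      have "0 < ?\<delta> n" by simp
      then obtain k x i where x: "delta_chain f (?\<delta> n) k x" "x 0 \<in> ?T" "i \<le> k"
        "\<epsilon> < infdist (x i) ?T"
        using neg by (meson not_le)
      have "i \<noteq> 0" using x \<open>0 < \<epsilon>\<close> by (metis infdist_zero not_less_iff_gr_or_eq)
      then have "chain_joins f (?\<delta> n) i (x 0) (x i)"
        using x unfolding chain_joins_def delta_chain_def by (intro exI[of _ x]) auto
      then show "\<exists>s w k. s \<in> ?T \<and> chain_joins f (?\<delta> n) k s w \<and> \<epsilon> < infdist w ?T"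
        using x by blast
    qed
    then obtain s w where sw: "\<And>n. s n \<in> ?T" "\<And>n. \<exists>k. chain_joins f (?\<delta> n) k (s n) (w n)"
      "\<And>n. \<epsilon> < infdist (w n) ?T"
      by metis
    have "seq_compact (UNIV :: ('a \<times> 'a) set)"
      using compact_Times[OF compact_X compact_X] by (simp add: compact_eq_seq_compact_metric)
    then obtain l r where r: "strict_mono (r :: nat \<Rightarrow> nat)" "((\<lambda>n. (s n, w n)) \<circ> r) \<longlonglongrightarrow> l"
      by (rule seq_compactE[where f = "\<lambda>n. (s n, w n)"]) auto
    have lim: "(s \<circ> r) \<longlonglongrightarrow> fst l" "(w \<circ> r) \<longlonglongrightarrow> snd l"
      using tendsto_fst[OF r(2)] tendsto_snd[OF r(2)] by (auto simp: o_def)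
    have \<delta>: "(?\<delta> \<circ> r) \<longlonglongrightarrow> 0"
      using LIMSEQ_subseq_LIMSEQ[OF LIMSEQ_inverse_real_of_nat r(1)] .
    have "chain_reaches f (fst l) (snd l)"
      by (rule chain_reaches_limit[OF cont _ \<delta> lim]) (use sw(2) in auto)
    moreover have "fst l \<in> ?T"
      using closed_sequentially[OF closed_terminal_set[OF cont] _ lim(1)] sw(1) by simp
    ultimately have "infdist (snd l) ?T = 0"
      using terminal_set_reaches by (metis infdist_zero)
    moreover have "\<epsilon> \<le> infdist (snd l) ?T"
      by (rule LIMSEQ_le_const[OF tendsto_infdist[OF lim(2)]]) (use sw(3) less_imp_le in auto)
    ultimately show False using \<open>0 < \<epsilon>\<close> by simp
  qed
qed

text \<open>
  A chain stable component \<open>D\<close> absorbs everything that is reachable from it, in particular the points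
  of the terminal set. So \<open>D\<close> meets the terminal set, which is itself an equivalence class.
\<close>

lemma unique_chain_stable_component_iff:
  fixes f :: "'a::metric_space \<Rightarrow> 'a"
  assumes compact_X: "compact (UNIV :: 'a set)" and cont: "continuous_on UNIV f"
    and prox: "chain_proximal f"
  shows "unique_chain_stable_component f C \<longleftrightarrow> C = terminal_set f"
proof -
  let ?T = "terminal_set f"
  obtain q where q: "q \<in> ?T" using terminal_set_nonempty[OF assms] by blast
  have comp: "?T \<in> chain_components f"
    unfolding chain_components_def
  proof -
    have "q \<in> chain_recurrent_set f"
      using q by (simp add: chain_recurrent_iff_reaches terminal_set_def)
    then have "chain_equiv f `` {q} \<in> chain_recurrent_set f // chain_equiv f"
      by (rule quotientI)
    then show "?T \<in> chain_recurrent_set f // chain_equiv f"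
      by (simp only: chain_equiv_class_terminal[OF q])
  qed
  have only: "D = ?T" if D: "D \<in> chain_components f" "chain_stable f D" for D
  proof -
    obtain p where p: "p \<in> chain_recurrent_set f" "D = chain_equiv f `` {p}"
      using D(1) unfolding chain_components_def by (rule quotientE)
    have pD: "p \<in> D" using p by (simp add: chain_equiv_def chain_recurrent_iff_reaches)
    have "infdist q D \<le> \<epsilon>" if "0 < \<epsilon>" for \<epsilon>
    proof -
      obtain \<delta> where \<delta>: "0 < \<delta>"
        "\<forall>k x. delta_chain f \<delta> k x \<and> x 0 \<in> D \<longrightarrow> (\<forall>i\<le>k. infdist (x i) D \<le> \<epsilon>)"
        using D(2) \<open>0 < \<epsilon>\<close> unfolding chain_stable_def by meson
      have "chain_reaches f p q" using q by (simp add: terminal_set_def)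
      then obtain k x where "delta_chain f \<delta> k x" "x 0 = p" "x k = q"
        using \<delta>(1) unfolding chain_reaches_def by blast
      then show ?thesis using \<delta>(2) pD by blast
    qed
    then have "infdist q D \<le> 0" by (rule field_le_epsilon[where y = 0, simplified])
    then have "infdist q D = 0" using infdist_nonneg[of q D] by linarith
    moreover have "closed D" using D(2) by (simp add: chain_stable_def)
    ultimately have "q \<in> D" using pD in_closed_iff_infdist_zero[of D q] by auto
    then have "chain_reaches f q p" using p(2) by (simp add: chain_equiv_def)
    then have "p \<in> ?T" using q terminal_set_reaches by blast
    then show ?thesis using p(2) chain_equiv_class_terminal by blast
  qed
  show ?thesis
    using comp only chain_stable_terminal_set[OF compact_X cont]
    unfolding unique_chain_stable_component_def by blast
qed

text \<open>
  The numbers \<open>a\<close> and \<open>a + 1\<close> generate all \<open>n \<ge> a\<^sup>2\<close>: write \<open>n = s a + r\<close> with \<open>r < a \<le> s\<close>; then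
  \<open>n = (s - r) a + r (a + 1)\<close>.
\<close>

lemma chain_joins_cycles:
  assumes "chain_joins f \<delta> a q q" and "chain_joins f \<delta> (Suc a) q q" and n: "a * a \<le> n"
  shows "chain_joins f \<delta> n q q"
proof -
  \<comment> \<open>A chain has positive length, so \<open>0\<close> is added by hand to get a set closed under sums and all multiples.\<close>
  define L where "L n \<longleftrightarrow> n = 0 \<or> chain_joins f \<delta> n q q" for n
  have add: "L (m + n)" if "L m" "L n" for m n
    using that chain_joins_trans[of f \<delta> m q q n q] by (auto simp: L_def)
  have mult: "L (s * m)" if "L m" for s m
  proof (induction s)
    case 0
    show ?case by (simp add: L_def)
  next
    case (Suc s)
    show ?case using add[OF that Suc] by simp
  qed
  have "0 < a" using chain_joins_pos[OF assms(1)] .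
  have "n mod a < a" "a \<le> n div a" using \<open>0 < a\<close> n
    by (simp_all add: div_le_mono less_eq_div_iff_mult_less_eq)
  then have le: "n mod a \<le> n div a" by linarith
  have "(n div a - n mod a) * a + n mod a * Suc a = n div a * a + n mod a"
    using le by (simp add: diff_mult_distrib)
  also have "\<dots> = n" by simp
  finally have "n = (n div a - n mod a) * a + n mod a * Suc a" by simp
  moreover have "L a" "L (Suc a)" using assms by (auto simp: L_def)
  ultimately have "L n" using add mult by metis
  moreover have "n \<noteq> 0" using n \<open>0 < a\<close> by (cases a) auto
  ultimately show ?thesis by (simp add: L_def)
qed

text \<open>
  Chains of equal length \<open>k\<close> from \<open>q\<close> and from \<open>f q\<close> to a common \<open>z\<close>, prolonged by a chain of length
  \<open>m\<close> from \<open>z\<close> back to \<open>q\<close>, give cycles at \<open>q\<close> of the consecutive lengths \<open>k + m\<close> and \<open>1 + (k + m)\<close>.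
\<close>

lemma chain_joins_terminal_eventually:
  assumes prox: "chain_proximal f" and q: "q \<in> terminal_set f" and \<delta>: "0 < \<delta>"
  shows "\<exists>N. \<forall>n\<ge>N. chain_joins f \<delta> n p q"
proof -
  have to_q: "\<exists>k. chain_joins f \<delta> k z q" for z
    using q \<delta> by (auto simp: terminal_set_def chain_reaches_iff_joins)
  obtain k z where z: "chain_joins f \<delta> k q z" "chain_joins f \<delta> k (f q) z"
    using prox \<delta> unfolding chain_proximal_iff_joins by blast
  obtain m where m: "chain_joins f \<delta> m z q" using to_q by blast
  have "chain_joins f \<delta> (1 + (k + m)) q q"
  proof (rule chain_joins_trans[OF _ chain_joins_trans[OF z(2) m]])
    show "chain_joins f \<delta> 1 q (f q)" using chain_joins_orbit[of 1 \<delta> f q] \<delta> by simp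
  qed
  then have cyc: "chain_joins f \<delta> n q q" if "(k + m) * (k + m) \<le> n" for n
    using chain_joins_cycles[OF chain_joins_trans[OF z(1) m]] that by simp
  obtain l where l: "chain_joins f \<delta> l p q" using to_q by blast
  have "chain_joins f \<delta> n p q" if "l + (k + m) * (k + m) \<le> n" for n
    using chain_joins_trans[OF l cyc[of "n - l"]] that by simp
  then show ?thesis by blast
qed

text \<open>
  Chains that start in a chain stable singleton cannot separate. If on the other hand \<open>T\<close> contains
  two points, every \<open>x\<close> can be joined to both of them by chains of the same large length, and half of
  their distance is a sensitivity constant that works for all \<open>x\<close>.
\<close>

lemma chain_sensitive_iff_terminal:
  fixes f :: "'a::metric_space \<Rightarrow> 'a"
  assumes compact_X: "compact (UNIV :: 'a set)" and cont: "continuous_on UNIV f"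
    and prox: "chain_proximal f"
  shows "chain_sensitive f \<longleftrightarrow> \<not> is_singleton (terminal_set f)"
proof
  assume "chain_sensitive f"
  then obtain e where e: "0 < e" "\<And>p. chain_sensitive_point f e p"
    unfolding chain_sensitive_def by blast
  show "\<not> is_singleton (terminal_set f)"
  proof
    assume "is_singleton (terminal_set f)"
    then obtain c where c: "terminal_set f = {c}" by (auto simp: is_singleton_def)
    have "0 < e / 2" using e(1) by simp
    then obtain \<delta> where \<delta>: "0 < \<delta>"
      "\<forall>k x. delta_chain f \<delta> k x \<and> x 0 \<in> {c} \<longrightarrow> (\<forall>i\<le>k. infdist (x i) {c} \<le> e / 2)"
      using chain_stable_terminal_set[OF compact_X cont] unfolding c chain_stable_def by blast
    have near: "dist (x k) c \<le> e / 2" if "delta_chain f \<delta> k x" "x 0 = c" for k x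
      using \<delta>(2) that by auto
    obtain k x y where "delta_chain f \<delta> k x" "delta_chain f \<delta> k y" "x 0 = c" "y 0 = c"
      "e < dist (x k) (y k)"
      using e(2)[of c] \<delta>(1) unfolding chain_sensitive_point_def by blast
    then show False
      using near[of k x] near[of k y] dist_triangle2[of "x k" "y k" c] by linarith
  qed
next
  assume "\<not> is_singleton (terminal_set f)"
  then obtain p q where pq: "p \<in> terminal_set f" "q \<in> terminal_set f" "p \<noteq> q"
    using terminal_set_nonempty[OF assms] by (metis all_not_in_conv is_singletonI')
  have "chain_sensitive_point f (dist p q / 2) x" for x
    unfolding chain_sensitive_point_def
  proof (intro allI impI)
    fix \<delta> :: real assume \<delta>: "0 < \<delta>"
    obtain M N where "\<And>n. n \<ge> M \<Longrightarrow> chain_joins f \<delta> n x p" "\<And>n. n \<ge> N \<Longrightarrow> chain_joins f \<delta> n x q"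
      using chain_joins_terminal_eventually[OF prox _ \<delta>] pq by metis
    then have "chain_joins f \<delta> (max M N) x p" "chain_joins f \<delta> (max M N) x q" by auto
    moreover have "dist p q / 2 < dist p q" using pq(3) by simp
    ultimately show "\<exists>k u v. delta_chain f \<delta> k u \<and> delta_chain f \<delta> k v \<and> u 0 = x \<and> v 0 = x \<and>
        dist p q / 2 < dist (u k) (v k)"
      unfolding chain_joins_def by metis
  qed
  moreover have "0 < dist p q / 2" using pq(3) by simp
  ultimately show "chain_sensitive f" unfolding chain_sensitive_def by blast
qed

section \<open>Generic pairs under shadowing\<close>

lemma residual_mono: "residual S \<Longrightarrow> S \<subseteq> T \<Longrightarrow> residual T"
  unfolding residual_def by (meson order_trans)

lemma residual_Int:
  assumes "residual S" and "residual T"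
  shows "residual (S \<inter> T)"
proof -
  obtain \<G> \<H> where "countable \<G>" "\<forall>U\<in>\<G>. open U \<and> closure U = UNIV" "\<Inter>\<G> \<subseteq> S"
    "countable \<H>" "\<forall>U\<in>\<H>. open U \<and> closure U = UNIV" "\<Inter>\<H> \<subseteq> T"
    using assms unfolding residual_def by metis
  then show ?thesis unfolding residual_def by (intro exI[of _ "\<G> \<union> \<H>"]) auto
qed

lemma residual_imp_dense:
  fixes S :: "'b::metric_space set"
  assumes compact: "compact (UNIV :: 'b set)" and "residual S"
  shows "closure S = UNIV"
proof -
  obtain \<G> where \<G>: "countable \<G>" "\<And>U. U \<in> \<G> \<Longrightarrow> open U \<and> closure U = UNIV" "\<Inter>\<G> \<subseteq> S"
    using \<open>residual S\<close> unfolding residual_def by metis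
  have "compact_space (euclidean :: 'b topology)"
    using compact by (simp add: compact_space_def)
  then have "locally_compact_space (euclidean :: 'b topology)"
    by (rule compact_imp_locally_compact_space)
  moreover have "regular_space (euclidean :: 'b topology)"
    by (simp add: metrizable_imp_regular_space metrizable_space_euclidean)
  ultimately have "euclidean closure_of \<Inter>\<G> = topspace (euclidean :: 'b topology)"
    using \<G> by (intro Baire_category) auto
  then show ?thesis using closure_mono[OF \<G>(3)] by auto
qed

text \<open>
  The chain is prolonged by the true orbit of its last point, which makes it an infinite pseudo
  orbit.
\<close>

lemma shadowing_chain_joins:
  assumes "shadowing_property f" and "0 < \<epsilon>"
  shows "\<exists>\<delta>>0. \<forall>p q n. chain_joins f \<delta> n p q \<longrightarrow> (\<exists>x. dist x p \<le> \<epsilon> \<and> dist ((f ^^ n) x) q \<le> \<epsilon>)"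
proof -
  obtain \<delta> where \<delta>: "0 < \<delta>" "\<And>x. pseudo_orbit f \<delta> x \<Longrightarrow> \<exists>p. shadowed_by f \<epsilon> x p"
    using assms unfolding shadowing_property_def by blast
  have "\<exists>x. dist x p \<le> \<epsilon> \<and> dist ((f ^^ n) x) q \<le> \<epsilon>" if joins: "chain_joins f \<delta> n p q" for p q n
  proof -
    obtain y where y: "\<And>i. i < n \<Longrightarrow> dist (f (y i)) (y (Suc i)) \<le> \<delta>" "y 0 = p" "y n = q"
      using joins by (auto simp: chain_joins_def delta_chain_def)
    define z where "z i = (if i \<le> n then y i else (f ^^ (i - n)) q)" for i
    have "dist (f (z i)) (z (Suc i)) \<le> \<delta>" for i
    proof (cases "i < n")
      case True
      then show ?thesis using y(1)[of i] by (simp add: z_def)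
    next
      case False
      then have "z (Suc i) = f (z i)"
        using y(3) by (auto simp: z_def Suc_diff_le)
      then show ?thesis using \<delta>(1) by simp
    qed
    then obtain x where x: "\<And>i. dist ((f ^^ i) x) (z i) \<le> \<epsilon>"
      using \<delta>(2)[of z] unfolding pseudo_orbit_def shadowed_by_def by blast
    have "dist x p \<le> \<epsilon>" "dist ((f ^^ n) x) q \<le> \<epsilon>"
      using x[of 0] x[of n] y by (auto simp: z_def)
    then show ?thesis by blast
  qed
  then show ?thesis using \<delta>(1) by blast
qed

lemma continuous_on_funpow:
  fixes f :: "'a::topological_space \<Rightarrow> 'a"
  assumes "continuous_on UNIV f"
  shows "continuous_on UNIV (f ^^ i)"
proof (induction i)
  case (Suc i)
  then show ?case
    using continuous_on_compose2[OF assms Suc] by (simp add: o_def)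
qed (simp add: id_def)

text \<open>
  A visit with precision \<open>1 / (m + 1)\<close> at some time \<open>i \<ge> N\<close> is an open condition on the pair. It is
  dense because the two coordinates of any given pair can be joined to \<open>p\<close> and \<open>q\<close> by chains of one
  common length \<open>n \<ge> N\<close>, and points that shadow these chains are near the given pair at time \<open>0\<close> and
  near \<open>(p, q)\<close> at time \<open>n\<close>.
\<close>

lemma residual_visits_terminal_pair:
  fixes f :: "'a::metric_space \<Rightarrow> 'a"
  assumes cont: "continuous_on UNIV f" and shadowing: "shadowing_property f"
    and prox: "chain_proximal f"
    and pq: "p \<in> terminal_set f" "q \<in> terminal_set f"
  shows "residual {(x, y). \<forall>\<epsilon>>0. \<exists>\<^sub>F i in sequentially.
           dist ((f ^^ i) x) p < \<epsilon> \<and> dist ((f ^^ i) y) q < \<epsilon>}" (is "residual ?R")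
proof -
  define U where "U m N = {z. \<exists>i\<ge>N. dist ((f ^^ i) (fst z)) p < inverse (real (Suc m)) \<and>
     dist ((f ^^ i) (snd z)) q < inverse (real (Suc m))}" for m N :: nat
  have "open (U m N)" for m N
  proof -
    have "U m N = (\<Union>i\<in>{N..}. {z. dist ((f ^^ i) (fst z)) p < inverse (real (Suc m))} \<inter>
        {z. dist ((f ^^ i) (snd z)) q < inverse (real (Suc m))})"
      by (auto simp: U_def)
    moreover have "open {z. dist ((f ^^ i) (g z)) a < \<eta>}"
      if g: "continuous_on UNIV g" for i a \<eta> and g :: "'a \<times> 'a \<Rightarrow> 'a"
      by (intro open_Collect_less continuous_on_dist continuous_on_const
          continuous_on_compose2[OF continuous_on_funpow[OF cont] g]) auto
    ultimately show ?thesis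
      by (simp add: open_UN open_Int continuous_on_fst continuous_on_snd)
  qed
  moreover have "closure (U m N) = UNIV" for m N
  proof -
    have "z \<in> closure (U m N)" for z
      unfolding closure_approachable
    proof (intro allI impI)
      fix e :: real assume "0 < e"
      \<comment> \<open>Both coordinates move by at most \<open>\<epsilon>\<close>, and shadowing gives weak inequalities.\<close>
      define \<epsilon> where "\<epsilon> = min (e / 3) (inverse (real (Suc m)) / 2)"
      have \<epsilon>: "0 < \<epsilon>" "\<epsilon> + \<epsilon> < e" "\<epsilon> < inverse (real (Suc m))"
        using \<open>0 < e\<close> by (auto simp: \<epsilon>_def min_def field_simps)
      obtain \<delta> where \<delta>: "0 < \<delta>" "\<And>p q n. chain_joins f \<delta> n p q \<Longrightarrow>
          (\<exists>x. dist x p \<le> \<epsilon> \<and> dist ((f ^^ n) x) q \<le> \<epsilon>)"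
        using shadowing_chain_joins[OF shadowing \<epsilon>(1)] by blast
      obtain K L where KL: "\<And>n. n \<ge> K \<Longrightarrow> chain_joins f \<delta> n (fst z) p"
        "\<And>n. n \<ge> L \<Longrightarrow> chain_joins f \<delta> n (snd z) q"
        using chain_joins_terminal_eventually[OF prox _ \<delta>(1)] pq by metis
      define n where "n = Max {K, L, N}"
      have n: "K \<le> n" "L \<le> n" "N \<le> n" by (auto simp: n_def)
      obtain x where x: "dist x (fst z) \<le> \<epsilon>" "dist ((f ^^ n) x) p \<le> \<epsilon>"
        using \<delta>(2)[OF KL(1)[OF n(1)]] by blast
      obtain y where y: "dist y (snd z) \<le> \<epsilon>" "dist ((f ^^ n) y) q \<le> \<epsilon>"
        using \<delta>(2)[OF KL(2)[OF n(2)]] by blast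
      have "dist (x, y) z \<le> dist x (fst z) + dist y (snd z)"
        by (cases z) (simp add: dist_Pair_Pair sqrt_sum_squares_le_sum)
      then have "dist (x, y) z < e" using x y \<epsilon> by linarith
      moreover have "(x, y) \<in> U m N"
        using x y \<epsilon> n(3) unfolding U_def by (intro CollectI exI[of _ n]) auto
      ultimately show "\<exists>w\<in>U m N. dist w z < e" by blast
    qed
    then show ?thesis by blast
  qed
  moreover have "(\<Inter>(range (case_prod U))) \<subseteq> ?R"
  proof clarify
    fix x y and \<epsilon> :: real
    assume *: "(x, y) \<in> \<Inter>(range (case_prod U))" and "0 < \<epsilon>"
    obtain m where m: "inverse (real (Suc m)) < \<epsilon>" using reals_Archimedean[OF \<open>0 < \<epsilon>\<close>] by blast
    have "(x, y) \<in> U m N" for N using * by auto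
    then have "\<exists>i\<ge>N. dist ((f ^^ i) x) p < \<epsilon> \<and> dist ((f ^^ i) y) q < \<epsilon>" for N
      using m by (fastforce simp: U_def)
    then show "\<exists>\<^sub>F i in sequentially. dist ((f ^^ i) x) p < \<epsilon> \<and> dist ((f ^^ i) y) q < \<epsilon>"
      by (auto simp: frequently_sequentially)
  qed
  ultimately show ?thesis
    unfolding residual_def by (intro exI[of _ "range (case_prod U)"]) auto
qed

lemma le_limsup_if_frequently:
  fixes a :: "nat \<Rightarrow> real"
  assumes "\<And>\<epsilon>. 0 < \<epsilon> \<Longrightarrow> \<exists>\<^sub>F i in sequentially. \<delta> - \<epsilon> < a i"
  shows "ereal \<delta> \<le> limsup (\<lambda>i. ereal (a i))"
proof (rule ccontr)
  assume "\<not> ?thesis"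
  then obtain t where t: "limsup (\<lambda>i. ereal (a i)) < ereal t" "ereal t < ereal \<delta>"
    using ereal_dense2[of "limsup (\<lambda>i. ereal (a i))" "ereal \<delta>"] by (auto simp: not_le)
  then have "\<forall>\<^sub>F i in sequentially. a i < t" using Limsup_lessD[OF t(1)] by simp
  moreover have "\<exists>\<^sub>F i in sequentially. \<delta> - (\<delta> - t) < a i" using assms[of "\<delta> - t"] t(2) by simp
  ultimately have "\<exists>\<^sub>F i in sequentially. \<delta> - (\<delta> - t) < a i \<and> a i < t"
    using frequently_eventually_frequently by blast
  then show False by (auto dest: frequently_ex)
qed

lemma liminf_zero_iff_frequently:
  fixes a :: "nat \<Rightarrow> real"
  assumes "\<And>i. 0 \<le> a i"
  shows "liminf (\<lambda>i. ereal (a i)) = 0 \<longleftrightarrow> (\<forall>\<epsilon>>0. \<exists>\<^sub>F i in sequentially. a i < \<epsilon>)"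
proof -
  have "liminf (\<lambda>i. ereal (a i)) = 0 \<longleftrightarrow> \<not> 0 < liminf (\<lambda>i. ereal (a i))"
    using Liminf_bounded[of 0 "\<lambda>i. ereal (a i)" sequentially] assms by auto
  moreover have "0 < liminf (\<lambda>i. ereal (a i)) \<longleftrightarrow> (\<exists>\<epsilon>>0. \<forall>\<^sub>F i in sequentially. \<epsilon> \<le> a i)"
  proof
    assume "0 < liminf (\<lambda>i. ereal (a i))"
    then obtain t where "0 < ereal t" "ereal t < liminf (\<lambda>i. ereal (a i))"
      using ereal_dense2 by blast
    then show "\<exists>\<epsilon>>0. \<forall>\<^sub>F i in sequentially. \<epsilon> \<le> a i"
      using less_LiminfD[of "ereal t" sequentially "\<lambda>i. ereal (a i)"]
      by (intro exI[of _ t]) (auto elim: eventually_mono)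
  next
    assume "\<exists>\<epsilon>>0. \<forall>\<^sub>F i in sequentially. \<epsilon> \<le> a i"
    then obtain \<epsilon> where "0 < \<epsilon>" "\<forall>\<^sub>F i in sequentially. \<epsilon> \<le> a i" by blast
    then have "ereal \<epsilon> \<le> liminf (\<lambda>i. ereal (a i))" by (intro Liminf_bounded) auto
    then show "0 < liminf (\<lambda>i. ereal (a i))" using \<open>0 < \<epsilon>\<close> by (metis ereal_less(2) less_le_trans)
  qed
  ultimately show ?thesis by (auto simp: frequently_def not_less)
qed

text \<open>
  For \<open>p \<noteq> q\<close> in \<open>T\<close>, a generic pair visits \<open>(p, p)\<close> and \<open>(p, q)\<close> infinitely often. The first makes
  it proximal and the second separates it by \<open>dist p q\<close>.
\<close>

lemma guC_if_terminal_not_singleton: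
  fixes f :: "'a::metric_space \<Rightarrow> 'a"
  assumes compact_X: "compact (UNIV :: 'a set)"
    and cont: "continuous_on UNIV f" and shadowing: "shadowing_property f"
    and prox: "chain_proximal f" and nonsing: "\<not> is_singleton (terminal_set f)"
  shows "exhibits_guC f"
proof -
  obtain p q where pq: "p \<in> terminal_set f" "q \<in> terminal_set f" "p \<noteq> q"
    using terminal_set_nonempty[OF compact_X cont prox] nonsing
    by (metis all_not_in_conv is_singletonI')
  define V where "V a b = {(x, y). \<forall>\<epsilon>>0. \<exists>\<^sub>F i in sequentially.
           dist ((f ^^ i) x) a < \<epsilon> \<and> dist ((f ^^ i) y) b < \<epsilon>}" for a b
  have "residual (V p p \<inter> V p q)"
    unfolding V_def by (intro residual_Int residual_visits_terminal_pair cont shadowing prox pq)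
  moreover have "V p p \<inter> V p q \<subseteq> chaotic_pairs_delta (dist p q) f"
  proof clarify
    fix x y assume xy: "(x, y) \<in> V p p" "(x, y) \<in> V p q"
    let ?d = "\<lambda>i. dist ((f ^^ i) x) ((f ^^ i) y)"
    have "\<exists>\<^sub>F i in sequentially. ?d i < \<epsilon>" if "0 < \<epsilon>" for \<epsilon>
    proof -
      have "\<exists>\<^sub>F i in sequentially. dist ((f ^^ i) x) p < \<epsilon>/2 \<and> dist ((f ^^ i) y) p < \<epsilon>/2"
        using xy(1) that unfolding V_def by (auto dest!: spec[of _ "\<epsilon>/2"])
      then show ?thesis
        by (rule frequently_elim1) (use dist_triangle_half_l in blast)
    qed
    then have "liminf (\<lambda>i. ereal (?d i)) = 0" by (subst liminf_zero_iff_frequently) auto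
    moreover have "\<exists>\<^sub>F i in sequentially. dist p q - \<epsilon> < ?d i" if "0 < \<epsilon>" for \<epsilon>
    proof -
      have "\<exists>\<^sub>F i in sequentially. dist ((f ^^ i) x) p < \<epsilon>/2 \<and> dist ((f ^^ i) y) q < \<epsilon>/2"
        using xy(2) that unfolding V_def by (auto dest!: spec[of _ "\<epsilon>/2"])
      then show ?thesis
      proof (rule frequently_elim1)
        fix i assume "dist ((f ^^ i) x) p < \<epsilon>/2 \<and> dist ((f ^^ i) y) q < \<epsilon>/2"
        then show "dist p q - \<epsilon> < ?d i"
          using dist_triangle3[of p q "(f ^^ i) x"] dist_triangle[of "(f ^^ i) x" q "(f ^^ i) y"]
          by linarith
      qed
    qed
    then have "ereal (dist p q) \<le> limsup (\<lambda>i. ereal (?d i))" by (rule le_limsup_if_frequently)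
    ultimately show "(x, y) \<in> chaotic_pairs_delta (dist p q) f"
      by (simp add: chaotic_pairs_delta_def)
  qed
  ultimately have "residual (chaotic_pairs_delta (dist p q) f)" by (rule residual_mono)
  moreover have "0 < dist p q" using pq(3) by simp
  ultimately show ?thesis unfolding exhibits_guC_def by blast
qed

section \<open>Consequences of chaos\<close>

lemma chaotic_pairs_deltaD:
  assumes "(x, y) \<in> chaotic_pairs_delta \<delta> f"
  shows "\<And>\<epsilon>. 0 < \<epsilon> \<Longrightarrow> \<exists>\<^sub>F i in sequentially. dist ((f ^^ i) x) ((f ^^ i) y) < \<epsilon>"
    and "\<And>e. \<forall>\<^sub>F i in sequentially. dist ((f ^^ i) x) ((f ^^ i) y) \<le> e \<Longrightarrow> \<delta> \<le> e"
proof -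
  show "\<exists>\<^sub>F i in sequentially. dist ((f ^^ i) x) ((f ^^ i) y) < \<epsilon>" if "0 < \<epsilon>" for \<epsilon>
    using assms that by (simp add: chaotic_pairs_delta_def liminf_zero_iff_frequently)
  fix e assume "\<forall>\<^sub>F i in sequentially. dist ((f ^^ i) x) ((f ^^ i) y) \<le> e"
  then have "limsup (\<lambda>i. ereal (dist ((f ^^ i) x) ((f ^^ i) y))) \<le> ereal e"
    by (intro Limsup_bounded) auto
  moreover have "ereal \<delta> \<le> limsup (\<lambda>i. ereal (dist ((f ^^ i) x) ((f ^^ i) y)))"
    using assms by (simp add: chaotic_pairs_delta_def)
  ultimately have "ereal \<delta> \<le> ereal e" by (rule order_trans[rotated])
  then show "\<delta> \<le> e" by simp
qed

text \<open>
  Replace \<open>p\<close> and \<open>q\<close> by a chaotic pair \<open>(x, y)\<close> near them. Their orbits are chains except for a small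
  first jump, and at a late time when they are close one of them can be redirected to the other.
\<close>

lemma chain_proximal_if_dense_chaotic_pairs:
  assumes cont: "continuous_on UNIV f" and dense: "closure (chaotic_pairs f) = UNIV"
  shows "chain_proximal f"
  unfolding chain_proximal_iff_joins
proof (intro allI impI)
  fix p q and \<delta> :: real assume "0 < \<delta>"
  then have \<delta>: "0 < \<delta> / 2" by simp
  obtain d where d: "0 < d" "\<And>x. dist x p < d \<Longrightarrow> dist (f x) (f p) < \<delta> / 2"
    using cont \<delta> unfolding continuous_on_iff by (metis UNIV_I)
  obtain e where e: "0 < e" "\<And>x. dist x q < e \<Longrightarrow> dist (f x) (f q) < \<delta> / 2"
    using cont \<delta> unfolding continuous_on_iff by (metis UNIV_I)
  have "(p, q) \<in> closure (chaotic_pairs f)" using dense by simp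
  then obtain w where w: "w \<in> chaotic_pairs f" "dist w (p, q) < min d e"
    unfolding closure_approachable using d(1) e(1) by (metis min_less_iff_conj)
  obtain x y where xy: "w = (x, y)" by (cases w)
  have "dist x p < d" "dist y q < e"
    using w(2) dist_fst_le[of w "(p, q)"] dist_snd_le[of w "(p, q)"] xy by auto
  then have near: "dist (f p) (f x) \<le> \<delta> / 2" "dist (f q) (f y) \<le> \<delta> / 2"
    using d(2)[of x] e(2)[of y] by (simp_all add: dist_commute[of "f p"] dist_commute[of "f q"])
  have "\<exists>\<^sub>F i in sequentially. dist ((f ^^ i) x) ((f ^^ i) y) < \<delta> / 2"
    using w(1) \<delta> chaotic_pairs_deltaD(1) unfolding xy chaotic_pairs_def by blast
  \<comment> \<open>The time must be positive, since chains of length \<open>0\<close> do not count.\<close>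
  then obtain i where i: "1 \<le> i" "dist ((f ^^ i) x) ((f ^^ i) y) < \<delta> / 2"
    unfolding frequently_sequentially by blast
  have orbit: "chain_joins f 0 i z ((f ^^ i) z)" for z
    by (rule chain_joins_orbit) (use i(1) in auto)
  have "chain_joins f (0 + \<delta>/2) i p ((f ^^ i) x)" "chain_joins f (0 + \<delta>/2) i q ((f ^^ i) y)"
    using chain_joins_move_start[OF orbit near(1)] chain_joins_move_start[OF orbit near(2)] .
  then have "chain_joins f \<delta> i p ((f ^^ i) x)" "chain_joins f (0 + \<delta>/2 + \<delta>/2) i q ((f ^^ i) x)"
    using chain_joins_move_end[of f "0 + \<delta>/2" i q "(f ^^ i) y" "(f ^^ i) x" "\<delta>/2"] i(2) \<delta>
    by (auto simp: dist_commute intro: chain_joins_mono)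
  then show "\<exists>k z. chain_joins f \<delta> k p z \<and> chain_joins f \<delta> k q z" by auto
qed

text \<open>
  A chain stable point \<open>c\<close> is Lyapunov stable: once an orbit is near \<open>c\<close>, a single small jump turns its
  remainder into a chain that starts at \<open>c\<close>.
\<close>

lemma chain_stable_point_attracts:
  fixes f :: "'a::metric_space \<Rightarrow> 'a"
  assumes cont: "continuous_on UNIV f" and stable: "chain_stable f {c}" and "0 < \<epsilon>"
  shows "\<exists>\<eta>>0. \<forall>x n. dist ((f ^^ n) x) c < \<eta> \<longrightarrow> (\<forall>i>n. dist ((f ^^ i) x) c \<le> \<epsilon>)"
proof -
  obtain \<delta> where \<delta>: "0 < \<delta>"
    "\<And>k x. delta_chain f \<delta> k x \<Longrightarrow> x 0 = c \<Longrightarrow> dist (x k) c \<le> \<epsilon>"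
    using stable \<open>0 < \<epsilon>\<close> unfolding chain_stable_def by auto
  obtain \<eta> where \<eta>: "0 < \<eta>" "\<And>u. dist u c < \<eta> \<Longrightarrow> dist (f u) (f c) < \<delta>"
    using cont \<delta>(1) unfolding continuous_on_iff by (metis UNIV_I)
  have "dist ((f ^^ i) x) c \<le> \<epsilon>" if near: "dist ((f ^^ n) x) c < \<eta>" and "n < i" for x n i
  proof -
    have "chain_joins f 0 (i - n) ((f ^^ n) x) ((f ^^ (i - n)) ((f ^^ n) x))"
      by (rule chain_joins_orbit) (use \<open>n < i\<close> in auto)
    moreover have "(f ^^ (i - n)) ((f ^^ n) x) = (f ^^ i) x"
      using funpow_add[of "i - n" n f] \<open>n < i\<close> by simp
    moreover have "dist (f c) (f ((f ^^ n) x)) \<le> \<delta>"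
      using \<eta>(2)[OF near] by (simp add: dist_commute)
    ultimately have "chain_joins f \<delta> (i - n) c ((f ^^ i) x)"
      using chain_joins_move_start[of f 0 "i - n" "(f ^^ n) x" "(f ^^ i) x" c \<delta>] by simp
    then show ?thesis using \<delta>(2) unfolding chain_joins_def by metis
  qed
  then show ?thesis using \<eta>(1) by blast
qed

text \<open>
  A pair close to \<open>(c, c)\<close> keeps both of its orbits within \<open>\<delta> / 3\<close> of \<open>c\<close>, so the upper limit of the
  distances is below \<open>\<delta>\<close>.
\<close>

lemma not_duC_if_chain_stable_point:
  fixes f :: "'a::metric_space \<Rightarrow> 'a"
  assumes cont: "continuous_on UNIV f" and stable: "chain_stable f {c}"
  shows "\<not> exhibits_duC f"
proof
  assume "exhibits_duC f"
  then obtain \<delta> where \<delta>: "0 < \<delta>" "closure (chaotic_pairs_delta \<delta> f) = UNIV"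
    unfolding exhibits_duC_def by blast
  obtain \<eta> where \<eta>: "0 < \<eta>"
    "\<And>x n i. dist ((f ^^ n) x) c < \<eta> \<Longrightarrow> n < i \<Longrightarrow> dist ((f ^^ i) x) c \<le> \<delta> / 3"
    using chain_stable_point_attracts[OF cont stable, of "\<delta> / 3"] \<delta>(1) by auto
  have "(c, c) \<in> closure (chaotic_pairs_delta \<delta> f)" using \<delta>(2) by simp
  then obtain w where w: "w \<in> chaotic_pairs_delta \<delta> f" "dist w (c, c) < \<eta>"
    unfolding closure_approachable using \<eta>(1) by blast
  obtain x y where xy: "w = (x, y)" by (cases w)
  have "dist ((f ^^ 0) x) c < \<eta>" "dist ((f ^^ 0) y) c < \<eta>"
    using w(2) dist_fst_le[of w "(c, c)"] dist_snd_le[of w "(c, c)"] xy by auto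
  then have "dist ((f ^^ i) x) ((f ^^ i) y) \<le> 2 * \<delta> / 3" if "0 < i" for i
    using \<eta>(2)[of 0 x i] \<eta>(2)[of 0 y i] that dist_triangle2[of "(f ^^ i) x" "(f ^^ i) y" c]
    by linarith
  then have "\<forall>\<^sub>F i in sequentially. dist ((f ^^ i) x) ((f ^^ i) y) \<le> 2 * \<delta> / 3"
    using eventually_gt_at_top[of 0] by (rule eventually_mono[rotated])
  then have "\<delta> \<le> 2 * \<delta> / 3" using chaotic_pairs_deltaD(2) w(1) xy by blast
  then show False using \<delta>(1) by simp
qed

text \<open>
  Here the separation constant of a chaotic pair is not bounded below, so pairs near \<open>(c, c)\<close> are no
  obstruction. But a generic pair comes arbitrarily close to \<open>(c, c)\<close> and stays there by stability, so
  it is asymptotic. If the chaotic pairs were residual, some of them would be asymptotic by Baire.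
\<close>

lemma not_gC_if_terminal_singleton:
  fixes f :: "'a::metric_space \<Rightarrow> 'a"
  assumes compact_X: "compact (UNIV :: 'a set)"
    and cont: "continuous_on UNIV f" and shadowing: "shadowing_property f"
    and prox: "chain_proximal f" and c: "terminal_set f = {c}"
  shows "\<not> exhibits_gC f"
proof
  define V where "V = {(x, y). \<forall>\<epsilon>>0. \<exists>\<^sub>F i in sequentially.
           dist ((f ^^ i) x) c < \<epsilon> \<and> dist ((f ^^ i) y) c < \<epsilon>}"
  assume "exhibits_gC f"
  then have "residual (chaotic_pairs f)" by (simp add: exhibits_gC_def)
  moreover have "residual V"
    unfolding V_def by (rule residual_visits_terminal_pair[OF cont shadowing prox]) (auto simp: c)
  ultimately have "residual (chaotic_pairs f \<inter> V)" by (rule residual_Int)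
  moreover have "compact (UNIV :: ('a \<times> 'a) set)"
    using compact_Times[OF compact_X compact_X] by simp
  ultimately have "closure (chaotic_pairs f \<inter> V) = UNIV" by (rule residual_imp_dense[rotated])
  then have "chaotic_pairs f \<inter> V \<noteq> {}" by auto
  then obtain x y \<delta> where xy: "0 < \<delta>" "(x, y) \<in> chaotic_pairs_delta \<delta> f" "(x, y) \<in> V"
    unfolding chaotic_pairs_def by auto
  have stable: "chain_stable f {c}" using chain_stable_terminal_set[OF compact_X cont] c by simp
  obtain \<eta> where \<eta>: "0 < \<eta>"
    "\<And>x n i. dist ((f ^^ n) x) c < \<eta> \<Longrightarrow> n < i \<Longrightarrow> dist ((f ^^ i) x) c \<le> \<delta> / 3"
    using chain_stable_point_attracts[OF cont stable, of "\<delta> / 3"] xy(1) by auto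
  have "\<exists>\<^sub>F i in sequentially. dist ((f ^^ i) x) c < \<eta> \<and> dist ((f ^^ i) y) c < \<eta>"
    using xy(3) \<eta>(1) unfolding V_def by blast
  then obtain n where n: "dist ((f ^^ n) x) c < \<eta>" "dist ((f ^^ n) y) c < \<eta>"
    by (auto dest: frequently_ex)
  have "dist ((f ^^ i) x) ((f ^^ i) y) \<le> 2 * \<delta> / 3" if "n < i" for i
    using \<eta>(2)[OF n(1) that] \<eta>(2)[OF n(2) that] dist_triangle2[of "(f ^^ i) x" "(f ^^ i) y" c]
    by linarith
  then have "\<forall>\<^sub>F i in sequentially. dist ((f ^^ i) x) ((f ^^ i) y) \<le> 2 * \<delta> / 3"
    using eventually_gt_at_top[of n] by (rule eventually_mono[rotated])
  then have "\<delta> \<le> 2 * \<delta> / 3" using chaotic_pairs_deltaD(2) xy(2) by blast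
  then show False using xy(1) by simp
qed

section \<open>Equivalence of the five properties\<close>

theorem theorem1p1:
  fixes f :: "'a::metric_space \<Rightarrow> 'a"
  assumes compact_X: "compact (UNIV :: 'a set)"
    and cont: "continuous_on UNIV f"
    and shadowing: "shadowing_property f"
  shows "((chain_sensitive f \<and> chain_proximal f) \<longleftrightarrow>
          (chain_proximal f \<and> (\<exists>C. unique_chain_stable_component f C \<and> \<not> is_singleton C))) \<and>
         ((chain_sensitive f \<and> chain_proximal f) \<longleftrightarrow> exhibits_guC f) \<and>
         ((chain_sensitive f \<and> chain_proximal f) \<longleftrightarrow> exhibits_duC f) \<and>
         ((chain_sensitive f \<and> chain_proximal f) \<longleftrightarrow> exhibits_gC f)"
proof -
  let ?P = "chain_proximal f \<and> \<not> is_singleton (terminal_set f)"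
  have one: "chain_sensitive f \<and> chain_proximal f \<longleftrightarrow> ?P"
    using chain_sensitive_iff_terminal[OF compact_X cont] by blast
  have two: "chain_proximal f \<and> (\<exists>C. unique_chain_stable_component f C \<and> \<not> is_singleton C) \<longleftrightarrow> ?P"
    by (metis unique_chain_stable_component_iff[OF compact_X cont])
  have compact_XX: "compact (UNIV :: ('a \<times> 'a) set)"
    using compact_Times[OF compact_X compact_X] by simp
  have sub: "chaotic_pairs_delta \<delta> f \<subseteq> chaotic_pairs f" if "0 < \<delta>" for \<delta>
    using that by (auto simp: chaotic_pairs_def)
  have P_gu: "?P \<Longrightarrow> exhibits_guC f"
    using guC_if_terminal_not_singleton[OF compact_X cont shadowing] by blast
  have gu_du: "exhibits_guC f \<Longrightarrow> exhibits_duC f"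
    unfolding exhibits_guC_def exhibits_duC_def using residual_imp_dense[OF compact_XX] by blast
  have gu_g: "exhibits_guC f \<Longrightarrow> exhibits_gC f"
    unfolding exhibits_guC_def exhibits_gC_def using residual_mono sub by blast
  have du_P: ?P if "exhibits_duC f"
  proof
    obtain \<delta> where "0 < \<delta>" "closure (chaotic_pairs_delta \<delta> f) = UNIV"
      using \<open>exhibits_duC f\<close> unfolding exhibits_duC_def by blast
    then have "closure (chaotic_pairs f) = UNIV" using closure_mono[OF sub] by blast
    then show "chain_proximal f" by (rule chain_proximal_if_dense_chaotic_pairs[OF cont])
    show "\<not> is_singleton (terminal_set f)"
      using that not_duC_if_chain_stable_point[OF cont] chain_stable_terminal_set[OF compact_X cont]
      by (metis is_singletonE)
  qed
  have g_P: ?P if "exhibits_gC f"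
  proof
    have "closure (chaotic_pairs f) = UNIV"
      using residual_imp_dense[OF compact_XX] that by (simp add: exhibits_gC_def)
    then show prox: "chain_proximal f" by (rule chain_proximal_if_dense_chaotic_pairs[OF cont])
    show "\<not> is_singleton (terminal_set f)"
      using that not_gC_if_terminal_singleton[OF compact_X cont shadowing prox]
      by (metis is_singletonE)
  qed
  show ?thesis unfolding one two using P_gu gu_du gu_g du_P g_P by blast
qed

end
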